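(* Let $K=\{(\rho,u,m)\in\mathbb{R}\times\mathbb{R}^2\times\mathbb{R}^2:\ |\rho|=1,\ m=\tfrac12\rho u\}$ and $\Lambda=\{(\rho,u,m)\in\mathbb{R}\times\mathbb{R}^2\times\mathbb{R}^2:\ |\rho|^2=|u|^2\}$. Then the $\Lambda$-convex hull of $K$ is $$K^{\Lambda}=\Bigl\{(\rho,u,m)\in\mathbb{R}\times\mathbb{R}^2\times\mathbb{R}^2:\ |\rho|\le 1,\ \bigl|m-\tfrac12\rho u\bigr|\le\tfrac12(1-\rho^2)\Bigr\}.$$
   Context: A function $f:\mathbb{R}\times\mathbb{R}^2\times\mathbb{R}^2\to\mathbb{R}$ is called $\Lambda$-convex if $s\mapsto f(w_0+sw)$ is convex on $\mathbb{R}$ for all $w_0\in\mathbb{R}\times\mathbb{R}^2\times\mathbb{R}^2$ and all $w\in\Lambda$. For a closed set $K\subset\mathbb{R}\times\mathbb{R}^2\times\mathbb{R}^2$, the $\Lambda$-convex hull $K^\Lambda$ is the set of all states that cannot be separated from $K$ by a $\Lambda$-convex function: $z\notin K^\Lambda$ if and only if there exists a $\Lambda$-convex function $f$ with $f\le 0$ on $K$ and $f(z)>0$. *)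

theory Defs
  imports "HOL-Analysis.Analysis"
begin

(* States (rho, u, m) in R x R^2 x R^2; norm on real^2 is the Euclidean one. *)
type_synonym state = "real \<times> (real ^ 2) \<times> (real ^ 2)"

definition Lambda_convex :: "'a::real_vector set \<Rightarrow> ('a \<Rightarrow> real) \<Rightarrow> bool" where
  "Lambda_convex L f \<longleftrightarrow>
     (\<forall>w0. \<forall>w\<in>L. convex_on UNIV (\<lambda>s::real. f (w0 + s *\<^sub>R w)))"

(* Meant for closed K. Separating functions are finite-valued and defined on the whole
   space; no regularity is required beyond convexity along the directions in L. *)
definition Lambda_hull :: "'a::real_vector set \<Rightarrow> 'a set \<Rightarrow> 'a set" where
  "Lambda_hull L K = {z. \<not> (\<exists>f. Lambda_convex L f \<and> (\<forall>x\<in>K. f x \<le> 0) \<and> f z > 0)}"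

definition K_set :: "state set" where
  "K_set = {(\<rho>, u, m). \<bar>\<rho>\<bar> = 1 \<and> m = ((1/2) * \<rho>) *\<^sub>R u}"

definition Lambda_cone :: "state set" where
  "Lambda_cone = {(\<rho>, u, m). \<bar>\<rho>\<bar>\<^sup>2 = (norm u)\<^sup>2}"

end

theory Submission
  imports Defs
begin

text \<open>
  Both inclusions rest on the defect \<open>m - (\<rho>/2) u\<close>, which vanishes exactly on \<open>K\<close> once
  \<open>\<bar>\<rho>\<bar> = 1\<close>.

  Upper bound. Along a line with direction \<open>(r, v, n)\<close> the defect is quadratic in the parameter, with
  leading coefficient \<open>- (r/2) v\<close>, and on \<open>\<Lambda>\<close> this vector has length \<open>r\<^sup>2/2\<close>. Adding \<open>\<rho>\<^sup>2/2\<close>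
  therefore exactly compensates the possible concavity of any component of the defect:
  \<open>e \<bullet> (m - (\<rho>/2) u) + (\<rho>\<^sup>2 - 1)/2\<close> is \<open>\<Lambda>\<close>-convex for \<open>norm e \<le> 1\<close>, and it vanishes on \<open>K\<close>. Taking
  \<open>e\<close> along the defect gives the inequality for the norm (\<open>hull_defect_le\<close>); the bound on
  \<open>\<bar>\<rho>\<bar>\<close> comes from the convex function \<open>\<bar>\<rho>\<bar> - 1\<close>.

  Lower bound. Extremality in the above inequality dictates the construction. A state whose defect is
  \<open>((1 - \<rho>\<^sup>2)/2) e\<close> with \<open>e\<close> a unit vector lies on a segment in the \<open>\<Lambda>\<close>-direction
  \<open>(1, e, (u - \<rho> e)/2)\<close> whose end points lie in \<open>K\<close>, one with density \<open>1\<close> and one with density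
  \<open>-1\<close> (\<open>extremal_defect_in_hull\<close>). Since \<open>(0, 0, e) \<in> \<Lambda>\<close>, every smaller defect is reached
  from two opposite extremal ones by moving \<open>m\<close> alone. So two rounds of lamination fill the set.
\<close>

section \<open>Elementary properties of the hull\<close>

lemma subset_Lambda_hull: "K \<subseteq> Lambda_hull L K"
  unfolding Lambda_hull_def by force

lemma Lambda_hull_le_zero:
  assumes "z \<in> Lambda_hull L K" "Lambda_convex L f" "\<And>x. x \<in> K \<Longrightarrow> f x \<le> 0"
  shows "f z \<le> 0"
  using assms unfolding Lambda_hull_def by force

text \<open>Lamination: a function that is convex along \<open>w\<close> and nonpositive at both ends of a segment in
  this direction is nonpositive in between, so it cannot separate an intermediate point either.\<close>

lemma Lambda_hull_segment:
  assumes w: "w \<in> L" and st: "s \<le> 0" "0 \<le> t"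
    and s: "z + s *\<^sub>R w \<in> Lambda_hull L K" and t: "z + t *\<^sub>R w \<in> Lambda_hull L K"
  shows "z \<in> Lambda_hull L K"
proof -
  have "f z \<le> 0" if f: "Lambda_convex L f" and fK: "\<forall>x\<in>K. f x \<le> 0" for f
  proof -
    let ?g = "\<lambda>s::real. f (z + s *\<^sub>R w)"
    have "convex_on UNIV ?g"
      using f w by (simp add: Lambda_convex_def)
    then have "convex_on (convex hull {s, t}) ?g"
      by (rule convex_on_subset) simp_all
    moreover have "\<forall>r\<in>{s, t}. ?g r \<le> 0"
      using Lambda_hull_le_zero[OF s f] Lambda_hull_le_zero[OF t f] fK by simp
    ultimately have "\<forall>r\<in>convex hull {s, t}. ?g r \<le> 0"
      by (rule convex_on_convex_hull_bound)
    moreover have "0 \<in> convex hull {s, t}"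
      using st by (simp add: segment_convex_hull[symmetric] closed_segment_eq_real_ivl)
    ultimately have "?g 0 \<le> 0"
      by (rule bspec)
    then show ?thesis by simp
  qed
  then show ?thesis unfolding Lambda_hull_def by force
qed

section \<open>The upper bound\<close>

lemma convex_on_quadratic:
  fixes a b c :: real
  assumes "0 \<le> a"
  shows "convex_on UNIV (\<lambda>s. a * s\<^sup>2 + b * s + c)"
proof (rule convex_onI)
  fix t x y :: real
  assume "0 < t" "t < 1"
  then have "0 \<le> a * (t * (1 - t)) * (x - y)\<^sup>2"
    using assms by simp
  also have "\<dots> = (1 - t) * (a * x\<^sup>2 + b * x + c) + t * (a * y\<^sup>2 + b * y + c)
      - (a * ((1 - t) * x + t * y)\<^sup>2 + b * ((1 - t) * x + t * y) + c)"
    by (simp add: power2_eq_square algebra_simps)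
  finally show "a * ((1 - t) *\<^sub>R x + t *\<^sub>R y)\<^sup>2 + b * ((1 - t) *\<^sub>R x + t *\<^sub>R y) + c
      \<le> (1 - t) * (a * x\<^sup>2 + b * x + c) + t * (a * y\<^sup>2 + b * y + c)"
    by simp
qed simp

lemma Lambda_convex_abs_density:
  "Lambda_convex L (\<lambda>(\<rho>::real, y::'a::real_vector). \<bar>\<rho>\<bar> - 1)"
  unfolding Lambda_convex_def
proof (intro allI ballI)
  fix w0 w :: "real \<times> 'a"
  have "\<bar>fst w0 + ((1 - t) * x + t * y) * fst w\<bar>
      \<le> (1 - t) * \<bar>fst w0 + x * fst w\<bar> + t * \<bar>fst w0 + y * fst w\<bar>"
    if "0 < t" "t < 1" for t x y
  proof -
    have "fst w0 + ((1 - t) * x + t * y) * fst w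
        = (1 - t) * (fst w0 + x * fst w) + t * (fst w0 + y * fst w)"
      by (simp add: algebra_simps)
    also have "\<bar>\<dots>\<bar> \<le> \<bar>(1 - t) * (fst w0 + x * fst w)\<bar> + \<bar>t * (fst w0 + y * fst w)\<bar>"
      by (rule abs_triangle_ineq)
    finally show ?thesis
      using that by (simp add: abs_mult)
  qed
  then show "convex_on UNIV (\<lambda>s. case w0 + s *\<^sub>R w of (\<rho>, y) \<Rightarrow> \<bar>\<rho>\<bar> - 1)"
    by (intro convex_onI) (auto simp: case_prod_beta algebra_simps)
qed

text \<open>The quadratic part in a direction \<open>(r, v, n)\<close> is \<open>(r\<^sup>2 - r (e \<bullet> v))/2\<close>, which is nonnegative by
  Cauchy-Schwarz because \<open>norm v = \<bar>r\<bar>\<close> on the cone and \<open>norm e \<le> 1\<close>.\<close>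

lemma Lambda_convex_defect:
  assumes e: "norm e \<le> 1"
  shows "Lambda_convex Lambda_cone
    (\<lambda>(\<rho>, u, m). e \<bullet> (m - ((1/2) * \<rho>) *\<^sub>R u) + \<rho>\<^sup>2 / 2 - 1 / 2)"
  unfolding Lambda_convex_def
proof (intro allI ballI)
  fix w0 w :: state
  assume w: "w \<in> Lambda_cone"
  obtain \<rho> u m where w0_eq: "w0 = (\<rho>, u, m)" by (cases w0)
  obtain r v n where w_eq: "w = (r, v, n)" by (cases w)
  have nv: "norm v = \<bar>r\<bar>"
    using w by (intro power2_eq_imp_eq[of "norm v" "\<bar>r\<bar>"]) (simp_all add: w_eq Lambda_cone_def)
  have "r * (e \<bullet> v) \<le> \<bar>r\<bar> * \<bar>e \<bullet> v\<bar>"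
    by (metis abs_ge_self abs_mult)
  also have "\<dots> \<le> \<bar>r\<bar> * (norm e * norm v)"
    by (intro mult_left_mono Cauchy_Schwarz_ineq2) simp
  also have "\<dots> \<le> \<bar>r\<bar> * (1 * norm v)"
    using e by (intro mult_left_mono mult_right_mono) auto
  also have "\<dots> = r\<^sup>2"
    by (simp add: nv power2_eq_square)
  finally have "0 \<le> (r\<^sup>2 - r * (e \<bullet> v)) / 2"
    by simp
  then have "convex_on UNIV (\<lambda>s. (r\<^sup>2 - r * (e \<bullet> v)) / 2 * s\<^sup>2
      + (e \<bullet> n - (\<rho> * (e \<bullet> v) + r * (e \<bullet> u)) / 2 + \<rho> * r) * s
      + (e \<bullet> m - \<rho> * (e \<bullet> u) / 2 + \<rho>\<^sup>2 / 2 - 1 / 2))"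
    by (rule convex_on_quadratic)
  also have "(\<lambda>s. (r\<^sup>2 - r * (e \<bullet> v)) / 2 * s\<^sup>2
      + (e \<bullet> n - (\<rho> * (e \<bullet> v) + r * (e \<bullet> u)) / 2 + \<rho> * r) * s
      + (e \<bullet> m - \<rho> * (e \<bullet> u) / 2 + \<rho>\<^sup>2 / 2 - 1 / 2))
    = (\<lambda>s. case w0 + s *\<^sub>R w of
        (\<rho>, u, m) \<Rightarrow> e \<bullet> (m - ((1/2) * \<rho>) *\<^sub>R u) + \<rho>\<^sup>2 / 2 - 1 / 2)"
    by (simp add: fun_eq_iff w0_eq w_eq inner_diff_right inner_add_right power2_eq_square
        field_simps)
  finally show "convex_on UNIV (\<lambda>s. case w0 + s *\<^sub>R w of
      (\<rho>, u, m) \<Rightarrow> e \<bullet> (m - ((1/2) * \<rho>) *\<^sub>R u) + \<rho>\<^sup>2 / 2 - 1 / 2)" .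
qed

lemma hull_density_le:
  assumes "(\<rho>, u, m) \<in> Lambda_hull Lambda_cone K_set"
  shows "\<bar>\<rho>\<bar> \<le> 1"
  using Lambda_hull_le_zero[OF assms Lambda_convex_abs_density] by (auto simp: K_set_def)

lemma hull_defect_le:
  assumes "(\<rho>, u, m) \<in> Lambda_hull Lambda_cone K_set"
  shows "norm (m - ((1/2) * \<rho>) *\<^sub>R u) \<le> (1/2) * (1 - \<rho>\<^sup>2)"
proof -
  let ?d = "m - ((1/2) * \<rho>) *\<^sub>R u"
  \<comment> \<open>Among the admissible \<open>e\<close>, \<open>sgn ?d\<close> gives the strongest bound; for a vanishing defect it is \<open>0\<close>.\<close>
  have "norm (sgn ?d) \<le> 1"
    by (simp add: norm_sgn)
  note convex = Lambda_convex_defect[OF this]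
  have "(case (\<rho>, u, m) of
      (\<rho>', u, m) \<Rightarrow> sgn ?d \<bullet> (m - ((1/2) * \<rho>') *\<^sub>R u) + \<rho>'\<^sup>2 / 2 - 1 / 2) \<le> 0"
    by (rule Lambda_hull_le_zero[OF assms convex]) (auto simp: K_set_def abs_square_le_1)
  moreover have "sgn ?d \<bullet> ?d = norm ?d"
    by (cases "?d = 0") (simp_all add: sgn_div_norm dot_square_norm power2_eq_square)
  ultimately show ?thesis
    by simp
qed

section \<open>The lower bound\<close>

text \<open>Requiring the line through the state in direction \<open>(1, e, n)\<close> to meet \<open>K\<close> at both densities
  \<open>1\<close> and \<open>-1\<close> gives two linear equations for \<open>n\<close> and \<open>m\<close>, whose unique solution is \<open>n = (u - \<rho> e)/2\<close> together with
  the value of \<open>m\<close> below.\<close>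

lemma extremal_defect_in_hull:
  assumes \<rho>: "\<bar>\<rho>\<bar> \<le> 1" and e: "norm e = 1"
  shows "(\<rho>, u, ((1/2) * \<rho>) *\<^sub>R u + ((1/2) * (1 - \<rho>\<^sup>2)) *\<^sub>R e)
    \<in> Lambda_hull Lambda_cone K_set" (is "?z \<in> _")
proof (rule Lambda_hull_segment)
  let ?w = "(1, e, (1/2) *\<^sub>R (u - \<rho> *\<^sub>R e)) :: state"
  show "?w \<in> Lambda_cone"
    using e by (simp add: Lambda_cone_def)
  show "- 1 - \<rho> \<le> 0" "0 \<le> 1 - \<rho>"
    using \<rho> by auto
  have "?z + (- 1 - \<rho>) *\<^sub>R ?w \<in> K_set" "?z + (1 - \<rho>) *\<^sub>R ?w \<in> K_set"
    by (auto simp: K_set_def vec_eq_iff power2_eq_square field_simps)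
  then show "?z + (- 1 - \<rho>) *\<^sub>R ?w \<in> Lambda_hull Lambda_cone K_set"
    "?z + (1 - \<rho>) *\<^sub>R ?w \<in> Lambda_hull Lambda_cone K_set"
    using subset_Lambda_hull by blast+
qed

lemma small_defect_in_hull:
  assumes \<rho>: "\<bar>\<rho>\<bar> \<le> 1"
    and defect: "norm (m - ((1/2) * \<rho>) *\<^sub>R u) \<le> (1/2) * (1 - \<rho>\<^sup>2)"
  shows "(\<rho>, u, m) \<in> Lambda_hull Lambda_cone K_set"
proof -
  define d where "d = m - ((1/2) * \<rho>) *\<^sub>R u"
  let ?R = "(1/2) * (1 - \<rho>\<^sup>2)"
  \<comment> \<open>If the defect vanishes it has no direction of its own, and any unit vector will do.\<close>
  obtain e :: "real^2" where e: "norm e = 1" and de: "norm d *\<^sub>R e = d"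
  proof (cases "d = 0")
    case True
    obtain e :: "real^2" where "norm e = 1"
      using vector_choose_size[of 1] by auto
    with True show ?thesis by (intro that[of e]) auto
  next
    case False
    then show ?thesis
      by (intro that[of "sgn d"]) (auto simp: norm_sgn sgn_div_norm)
  qed
  have m: "m = ((1/2) * \<rho>) *\<^sub>R u + norm d *\<^sub>R e"
    unfolding de by (simp add: d_def)
  show ?thesis
  proof (rule Lambda_hull_segment)
    show "(0, 0, e) \<in> Lambda_cone"
      by (simp add: Lambda_cone_def)
    show "- ?R - norm d \<le> 0" "0 \<le> ?R - norm d"
      using defect[folded d_def] norm_ge_zero[of d] by linarith+
    have "(\<rho>, u, m) + (- ?R - norm d) *\<^sub>R (0, 0, e) = (\<rho>, u, ((1/2) * \<rho>) *\<^sub>R u + ?R *\<^sub>R (- e))"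
      by (simp add: m algebra_simps)
    also have "\<dots> \<in> Lambda_hull Lambda_cone K_set"
      using \<rho> e by (intro extremal_defect_in_hull) simp_all
    finally show "(\<rho>, u, m) + (- ?R - norm d) *\<^sub>R (0, 0, e) \<in> Lambda_hull Lambda_cone K_set" .
    have "(\<rho>, u, m) + (?R - norm d) *\<^sub>R (0, 0, e) = (\<rho>, u, ((1/2) * \<rho>) *\<^sub>R u + ?R *\<^sub>R e)"
      by (simp add: m algebra_simps)
    also have "\<dots> \<in> Lambda_hull Lambda_cone K_set"
      using \<rho> e by (rule extremal_defect_in_hull)
    finally show "(\<rho>, u, m) + (?R - norm d) *\<^sub>R (0, 0, e) \<in> Lambda_hull Lambda_cone K_set" .
  qed
qed

theorem proposition2p3:
  shows "Lambda_hull Lambda_cone K_set =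
    {(\<rho>, u, m). \<bar>\<rho>\<bar> \<le> 1 \<and> norm (m - ((1/2) * \<rho>) *\<^sub>R u) \<le> (1/2) * (1 - \<rho>\<^sup>2)}"
  by (auto intro!: small_defect_in_hull dest: hull_density_le hull_defect_le)

end
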